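(* Let $N$ be a positive integer, not a perfect square, with $N\equiv 1 \pmod 4$, let $\alpha$ be the normalized square root of $N$, and let $\{x_i\}_{i\in\mathbb{Z}}$ be the two-sided continued fraction of $x_0=\alpha$, with associated $P_i,Q_i,b_i$ ($i\in\mathbb{Z}$) as defined in the context. (a) For all $i\in\mathbb{Z}$, $x_i$ has the form $x_i=\frac{\sqrt{N}+P_{i-1}}{Q_i}$ with unique integers $P_{i-1},Q_i$, and for all $i\in\mathbb{Z}$: (i) $N=P_i^2+Q_iQ_{i+1}$; (ii) $P_i=b_iQ_i-P_{i-1}$; (iii) $b_i=\left\lfloor \frac{\lfloor\sqrt{N}\rfloor+P_{i-1}}{Q_i}\right\rfloor\ge 1$; (iv) $0<P_i<\sqrt{N}$; (v) $|\sqrt{N}-Q_i|<P_{i-1}$; (vi) $Q_i$ is an integer; (vii) $Q_{i+1}=Q_{i-1}+b_i(P_{i-1}-P_i)$; (viii) $\left\lfloor\frac{\sqrt{N}+P_i}{Q_i}\right\rfloor=\left\lfloor\frac{\sqrt{N}+P_{i-1}}{Q_i}\right\rfloor=b_i$; and the sequence is eventually periodic. (b) There exists a positive integer $\pi$ such that $x_i=x_{i+\pi}$ for all $i\in\mathbb{Z}$. (c) For $x_0=\alpha$ (so that $Q_0\mid 2P_{-1}$), the sequence $\{Q_i\}$ is symmetric about $Q_0$: $Q_i=Q_{-i}$ for all $i\in\mathbb{Z}$.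
   Context: Normalized square root of $N$: $\alpha=\frac{\sqrt{N}+\lfloor\sqrt{N}\rfloor-1}{2}$ if $\lfloor\sqrt{N}\rfloor$ is even, and $\alpha=\frac{\sqrt{N}+\lfloor\sqrt{N}\rfloor}{2}$ if $\lfloor\sqrt{N}\rfloor$ is odd. Forward terms: $x_0=\alpha$, $b_i=\lfloor x_i\rfloor$, $x_{i+1}=\frac{1}{x_i-b_i}$ for $i\ge 0$. Each $x_i$ is written as $x_i=\frac{\sqrt{N}+P_{i-1}}{Q_i}$ with $P_{i-1},Q_i$ integers (in particular $Q_0=2$, and $P_{-1}$ is $\lfloor\sqrt N\rfloor-1$ or $\lfloor\sqrt N\rfloor$ according to parity). Backward terms: the expansion is continued to negative indices by running the same recursion in reverse. Namely, put $y_0=\frac{\sqrt{N}+P_0}{Q_0}$ and $y_j=\frac{1}{y_{j-1}-\lfloor y_{j-1}\rfloor}$ for $j\ge 1$; write $y_j=\frac{\sqrt{N}+P_{-j}}{Q_{-j}}$, which defines $P_{-j}$ and $Q_{-j}$ for $j\ge 1$ (for $j=1$ this value of $P_{-1}$ agrees with the one given by $x_0$). Then $x_{-j}=\frac{\sqrt{N}+P_{-j-1}}{Q_{-j}}$ and $b_{-j}=\lfloor x_{-j}\rfloor$ for $j\ge 1$. The sequence $\{x_i\}_{i\in\mathbb{Z}}$ is the two-sided continued fraction of $x_0$. *)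

theory Defs
  imports Complex_Main "HOL-Computational_Algebra.Nth_Powers" "HOL-Number_Theory.Cong"
begin

definition normalized_sqrt :: "nat \<Rightarrow> real" where
  "normalized_sqrt N =
     (if even \<lfloor>sqrt N\<rfloor> then (sqrt N + of_int \<lfloor>sqrt N\<rfloor> - 1) / 2
      else (sqrt N + of_int \<lfloor>sqrt N\<rfloor>) / 2)"

primrec complete_quotient :: "real \<Rightarrow> nat \<Rightarrow> real" where
  "complete_quotient x 0 = x"
| "complete_quotient x (Suc n) =
     1 / (complete_quotient x n - of_int \<lfloor>complete_quotient x n\<rfloor>)"

text \<open>The integers \<open>p\<close>, \<open>q\<close> are kept as real numbers with explicit membership in \<open>\<int>\<close>, so that
  integrality of the sequences \<open>P\<close> and \<open>Q\<close> below is a proposition rather than a matter of typing.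
  The condition \<open>q \<noteq> 0\<close> excludes the HOL convention for division by zero.\<close>

definition surd_form :: "nat \<Rightarrow> real \<Rightarrow> real \<Rightarrow> real \<Rightarrow> bool" where
  "surd_form N x p q \<longleftrightarrow> p \<in> \<int> \<and> q \<in> \<int> \<and> q \<noteq> 0 \<and> x = (sqrt N + p) / q"

definition surd_P :: "nat \<Rightarrow> real \<Rightarrow> real" where
  "surd_P N x = (THE p. \<exists>q. surd_form N x p q)"

definition surd_Q :: "nat \<Rightarrow> real \<Rightarrow> real" where
  "surd_Q N x = (THE q. \<exists>p. surd_form N x p q)"

definition fwd :: "nat \<Rightarrow> nat \<Rightarrow> real" where
  "fwd N i = complete_quotient (normalized_sqrt N) i"

text \<open>The backward terms \<open>y\<^sub>j\<close>: since \<open>x\<^sub>i = (\<surd>N + P\<^sub>i\<^sub>-\<^sub>1) / Q\<^sub>i\<close>, the starting value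
  \<open>y\<^sub>0 = (\<surd>N + P\<^sub>0) / Q\<^sub>0\<close> takes \<open>P\<^sub>0\<close> from \<open>x\<^sub>1\<close> and \<open>Q\<^sub>0\<close> from \<open>x\<^sub>0\<close>.\<close>

definition bwd :: "nat \<Rightarrow> nat \<Rightarrow> real" where
  "bwd N j =
     complete_quotient ((sqrt N + surd_P N (fwd N 1)) / surd_Q N (fwd N 0)) j"

text \<open>The index of \<open>P\<close> is shifted by one in \<open>x\<^sub>i = (\<surd>N + P\<^sub>i\<^sub>-\<^sub>1) / Q\<^sub>i\<close> but not in
  \<open>y\<^sub>j = (\<surd>N + P\<^sub>-\<^sub>j) / Q\<^sub>-\<^sub>j\<close>. Both \<open>x\<^sub>0\<close> and \<open>y\<^sub>1\<close> provide a value for \<open>P\<^sub>-\<^sub>1\<close>;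
  the one from \<open>x\<^sub>0\<close> is taken here, and the two agree.\<close>

definition cf_P :: "nat \<Rightarrow> int \<Rightarrow> real" where
  "cf_P N i = (if i \<ge> -1 then surd_P N (fwd N (nat (i + 1))) else surd_P N (bwd N (nat (- i))))"

definition cf_Q :: "nat \<Rightarrow> int \<Rightarrow> real" where
  "cf_Q N i = (if i \<ge> 0 then surd_Q N (fwd N (nat i)) else surd_Q N (bwd N (nat (- i))))"

definition cf_x :: "nat \<Rightarrow> int \<Rightarrow> real" where
  "cf_x N i = (if i \<ge> 0 then fwd N (nat i) else (sqrt N + cf_P N (i - 1)) / cf_Q N i)"

definition cf_b :: "nat \<Rightarrow> int \<Rightarrow> int" where
  "cf_b N i = \<lfloor>cf_x N i\<rfloor>"

end

theory Submission
  imports Defs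
begin

text \<open>A quadratic surd \<open>(\<surd>N + p) / q\<close> is followed through the integer pair \<open>(p, q)\<close>. The pairs of
  reduced surds are preserved by a continued fraction step, there are finitely many of them, and the
  step is undone by the same recursion run in reverse. Since \<open>Q\<^sub>0 = 2\<close> and \<open>P\<^sub>0 \<equiv> P\<^sub>-\<^sub>1 (mod 2)\<close> both lie in
  the interval \<open>(\<surd>N - 2, \<surd>N)\<close>, they coincide, so the backward expansion starts at \<open>y\<^sub>0 = x\<^sub>0\<close> and
  is the forward one. This gives the symmetry, and reduces all identities at negative indices to
  those at nonnegative ones; periodicity is the pigeonhole principle together with invertibility.\<close>

section \<open>Irrationality of \<open>sqrt N\<close> and uniqueness of the surd
  representation\<close>

lemma not_is_square_sqrt_irrational:
  fixes a b :: int
  assumes "\<not> is_square N" "b \<noteq> 0"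
  shows "sqrt (real N) * b \<noteq> a"
proof
  assume "sqrt (real N) * b = a"
  then have "(sqrt (real N) * b)\<^sup>2 = (of_int a)\<^sup>2" by simp
  then have "of_int (int N * b\<^sup>2) = (of_int (a\<^sup>2) :: real)"
    by (simp add: power_mult_distrib)
  then have eq: "int N * b\<^sup>2 = a\<^sup>2" by linarith
  then have "b\<^sup>2 dvd a\<^sup>2" by (metis dvd_triv_right)
  then have "b dvd a" by simp
  then obtain c where "a = b * c" ..
  with eq assms(2) have "int N = c\<^sup>2" by (simp add: power_mult_distrib)
  then have "N = (nat \<bar>c\<bar>)\<^sup>2"
    by (metis nat_int nat_power_eq abs_ge_zero power2_abs)
  with assms(1) show False by (auto simp: is_nth_power_def)
qed

text \<open>Cross-multiplication makes \<open>sqrt N\<close> times the difference of the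
  denominators an integer, so irrationality forces the denominators to agree; cancelling them
  identifies the numerators.\<close>

lemma surd_form_unique:
  assumes "\<not> is_square N" "surd_form N x p q" "surd_form N x p' q'"
  shows "p = p' \<and> q = q'"
proof -
  from assms(2,3) obtain a b a' b' :: int
    where eqs: "p = a" "q = b" "p' = a'" "q' = b'" "b \<noteq> 0" "b' \<noteq> 0"
      and "(sqrt N + a) / b = (sqrt N + a') / b'"
    unfolding surd_form_def by (auto elim!: Ints_cases)
  then have "(sqrt N + a) * b' = (sqrt N + a') * b" by (simp add: frac_eq_eq)
  then have lin: "sqrt N * of_int (b' - b) = of_int (a' * b - a * b')"
    by (simp add: algebra_simps)
  then have "b' = b"
    using not_is_square_sqrt_irrational[OF assms(1), of "b' - b" "a' * b - a * b'"] by auto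
  with lin have "a' * b = a * b"
    by simp
  with eqs \<open>b' = b\<close> show ?thesis by simp
qed

lemma surd_P_eq:
  assumes "\<not> is_square N" "surd_form N x p q"
  shows "surd_P N x = p"
  unfolding surd_P_def
proof (rule the_equality)
  show "\<exists>q. surd_form N x p q" using assms(2) by blast
  show "p' = p" if "\<exists>q. surd_form N x p' q" for p'
    using that surd_form_unique[OF assms] by blast
qed

lemma surd_Q_eq:
  assumes "\<not> is_square N" "surd_form N x p q"
  shows "surd_Q N x = q"
  unfolding surd_Q_def
proof (rule the_equality)
  show "\<exists>p. surd_form N x p q" using assms(2) by blast
  show "q' = q" if "\<exists>p. surd_form N x p q'" for q'
    using that surd_form_unique[OF assms] by blast
qed

section \<open>Reduced pairs and the continued fraction step\<close>

definition surd :: "nat \<Rightarrow> int \<times> int \<Rightarrow> real" where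
  "surd N = (\<lambda>(p, q). (sqrt N + p) / q)"

text \<open>For \<open>q > 0\<close> the inequalities say that the surd exceeds 1 and that its
  conjugate \<open>(p - sqrt N) / q\<close> lies strictly between -1 and 0. The divisibility keeps
  the next denominator an integer.\<close>

definition reduced :: "nat \<Rightarrow> int \<times> int \<Rightarrow> bool" where
  "reduced N = (\<lambda>(p, q). q > 0 \<and> p < sqrt N \<and> sqrt N - p < q \<and> q < sqrt N + p \<and>
     q dvd int N - p\<^sup>2)"

text \<open>Sends (P_{i-1}, Q_i) to (P_i, Q_{i+1}); the division is exact on reduced pairs.\<close>

definition cf_step :: "nat \<Rightarrow> int \<times> int \<Rightarrow> int \<times> int" where
  "cf_step N = (\<lambda>(p, q). let p' = \<lfloor>surd N (p, q)\<rfloor> * q - p in (p', (int N - p'\<^sup>2) div q))"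

lemma reduced_pos:
  assumes "reduced N (p, q)"
  shows "p > 0" "q > 0"
  using assms unfolding reduced_def by auto

lemma surd_form_surd:
  assumes "reduced N (p, q)"
  shows "surd_form N (surd N (p, q)) p q"
  using assms by (auto simp: surd_form_def surd_def reduced_def)

lemma floor_surd_ge_1:
  assumes "reduced N (p, q)"
  shows "\<lfloor>surd N (p, q)\<rfloor> \<ge> 1"
  using assms by (simp add: surd_def reduced_def)

text \<open>Dividing by a positive integer and taking the floor depends only on the floor of the
  numerator.\<close>

lemma floor_surd_floor_sqrt:
  assumes "reduced N (p, q)"
  shows "\<lfloor>(of_int \<lfloor>sqrt N\<rfloor> + of_int p) / of_int q :: real\<rfloor> = \<lfloor>surd N (p, q)\<rfloor>"
proof -
  have "q > 0" using reduced_pos[OF assms] by simp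
  have "\<lfloor>surd N (p, q)\<rfloor> = \<lfloor>sqrt N + p\<rfloor> div q"
    using \<open>q > 0\<close> by (simp add: surd_def floor_divide_real_eq_div)
  moreover have "\<lfloor>of_int (\<lfloor>sqrt N\<rfloor> + p) / of_int q :: real\<rfloor> = (\<lfloor>sqrt N\<rfloor> + p) div q"
    by (rule floor_divide_of_int_eq)
  ultimately show ?thesis by simp
qed

text \<open>Everything follows from the factorization
  \<open>q * q' = (sqrt N - p') * (sqrt N + p')\<close> together with bounds on its two factors. The
  mixed pair \<open>(p', q)\<close>, new numerator over old denominator, is the backward term; its
  being reduced with the same floor is what makes the step reversible.\<close>

lemma cf_step_reduced:
  assumes "\<not> is_square N" "reduced N (p, q)" "cf_step N (p, q) = (p', q')"
  shows "reduced N (p', q')"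
    and "p' = \<lfloor>surd N (p, q)\<rfloor> * q - p"
    and "int N = p'\<^sup>2 + q * q'"
    and "reduced N (p', q)"
    and "\<lfloor>surd N (p', q)\<rfloor> = \<lfloor>surd N (p, q)\<rfloor>"
    and "1 / (surd N (p, q) - of_int \<lfloor>surd N (p, q)\<rfloor>) = surd N (p', q')"
proof -
  define b where "b = \<lfloor>surd N (p, q)\<rfloor>"
  from assms(2) have q: "q > 0" and p: "p < sqrt N" "sqrt N - p < q" "q < sqrt N + p"
    and dvd: "q dvd int N - p\<^sup>2"
    by (auto simp: reduced_def)
  from assms(3) have p': "p' = b * q - p" and q': "q' = (int N - p'\<^sup>2) div q"
    by (auto simp: cf_step_def b_def Let_def)
  show "p' = \<lfloor>surd N (p, q)\<rfloor> * q - p" using p' b_def by simp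
  \<comment> \<open>Modulo \<open>q\<close>, \<open>p'\<close> is \<open>-p\<close>, so the squares
    agree.\<close>
  have "int N - p'\<^sup>2 = (int N - p\<^sup>2) + q * (b * (2 * p - b * q))"
    by (simp add: p' power2_eq_square algebra_simps)
  with dvd have "q dvd int N - p'\<^sup>2" by (metis dvd_add dvd_triv_left)
  with q' have qq: "q * q' = int N - p'\<^sup>2" by simp
  then show "int N = p'\<^sup>2 + q * q'" by simp
  then have "of_int (int N) = (of_int (p'\<^sup>2 + q * q') :: real)" by simp
  then have N: "real N = (of_int p')\<^sup>2 + of_int q * of_int q'" by simp
  have frac: "surd N (p, q) - b = (sqrt N - p') / q"
    using q by (simp add: surd_def p' field_simps)
  \<comment> \<open>Irrationality makes the lower bound 0 on the fractional part strict.\<close>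
  have "sqrt N \<noteq> p'" using not_is_square_sqrt_irrational[OF assms(1), of 1 p'] by simp
  moreover have "0 \<le> (sqrt N - p') / q" "(sqrt N - p') / q < 1"
    unfolding frac[symmetric] b_def by linarith+
  ultimately have lo: "p' < sqrt N" and hi: "sqrt N - p' < q"
    using q by (auto simp: field_simps)
  have "b \<ge> 1" using floor_surd_ge_1[OF assms(2)] b_def by simp
  then have "b * q \<ge> q" using q by simp
  then have ge: "p' \<ge> q - p" using p' by simp
  then have ge': "real_of_int p' \<ge> q - p" by linarith
  \<comment> \<open>Adding \<open>p' \<ge> q - p\<close> and \<open>p' > sqrt N - q\<close> gives
    \<open>2 * p' > sqrt N - p\<close>, which is positive.\<close>
  have "p' > 0" using ge' p hi by linarith
  have fact: "of_int q * of_int q' = (sqrt N - p') * (sqrt N + p')"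
    using N by (simp add: algebra_simps power2_eq_square)
  have "(sqrt N - p') * (sqrt N + p') > 0" using lo \<open>p' > 0\<close> by simp
  then have "q' > 0" using fact q by (metis of_int_0_less_iff zero_less_mult_pos)
  have "sqrt N - p' < q'"
  proof -
    \<comment> \<open>Since \<open>p < sqrt N\<close>, the bound \<open>q \<le> p' + p\<close>
      yields \<open>q < sqrt N + p'\<close>; the factorization then allows \<open>q\<close> to be
      cancelled.\<close>
    have "(sqrt N - p') * q < (sqrt N - p') * (sqrt N + p')"
      using lo ge' p by (intro mult_strict_left_mono) auto
    then show ?thesis using q unfolding fact[symmetric] by (simp add: mult.commute)
  qed
  moreover have "q' < sqrt N + p'"
  proof -
    have "(sqrt N - p') * (sqrt N + p') < q * (sqrt N + p')"
      using hi lo \<open>p' > 0\<close> by (intro mult_strict_right_mono) auto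
    then show ?thesis using q unfolding fact[symmetric] by simp
  qed
  moreover have "q' dvd int N - p'\<^sup>2" using qq by (metis dvd_triv_right)
  ultimately show "reduced N (p', q')" using lo \<open>q' > 0\<close> by (simp add: reduced_def)
  show "reduced N (p', q)"
    using lo hi q ge' p \<open>q dvd int N - p'\<^sup>2\<close> by (simp add: reduced_def)
  \<comment> \<open>The mixed surd is \<open>b\<close> minus the conjugate of the old surd, and that
    conjugate lies between -1 and 0.\<close>
  have "surd N (p', q) = (sqrt N - p) / q + b" using q by (simp add: surd_def p' field_simps)
  moreover have "0 \<le> (sqrt N - p) / q" "(sqrt N - p) / q < 1" using q p by auto
  ultimately show "\<lfloor>surd N (p', q)\<rfloor> = \<lfloor>surd N (p, q)\<rfloor>"
    unfolding b_def[symmetric] by (simp add: floor_eq_iff)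
  have "q / (sqrt N - p') = (sqrt N + p') / q'"
    using fact lo \<open>q' > 0\<close> by (simp add: frac_eq_eq mult.commute)
  then show "1 / (surd N (p, q) - of_int \<lfloor>surd N (p, q)\<rfloor>) = surd N (p', q')"
    unfolding b_def[symmetric] frac by (simp add: surd_def)
qed

text \<open>The relation \<open>N = p'^2 + q * q'\<close> is symmetric in the two denominators, and
  the mixed surd \<open>(p'', q')\<close> has the same floor as \<open>(p', q')\<close>. Hence the
  step applied to the mixed pair of the second step returns the mixed pair of the first.\<close>

lemma cf_step_reverse:
  assumes "\<not> is_square N" "reduced N (p, q)"
    and "cf_step N (p, q) = (p', q')" "cf_step N (p', q') = (p'', q'')"
  shows "reduced N (p'', q') \<and> cf_step N (p'', q') = (p', q)"
proof -
  note step = cf_step_reduced[OF assms(1-3)]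
  note step' = cf_step_reduced[OF assms(1) step(1) assms(4)]
  have "q' > 0" using reduced_pos[OF step(1)] by simp
  have "\<lfloor>surd N (p'', q')\<rfloor> * q' - p'' = p'" using step'(2,5) by simp
  moreover have "(int N - p'\<^sup>2) div q' = q" using step(3) \<open>q' > 0\<close> by simp
  ultimately show ?thesis using step'(4) by (simp add: cf_step_def)
qed

text \<open>The image \<open>(p', q')\<close> determines \<open>q\<close> through
  \<open>N = p'^2 + q * q'\<close>, then the partial quotient as the floor of the mixed surd
  \<open>(p', q)\<close>, and finally \<open>p\<close>.\<close>

lemma inj_on_cf_step:
  assumes "\<not> is_square N"
  shows "inj_on (cf_step N) {s. reduced N s}"
proof (rule inj_onI, clarsimp)
  fix p q u v
  assume red: "reduced N (p, q)" "reduced N (u, v)" and eq: "cf_step N (p, q) = cf_step N (u, v)"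
  obtain p' q' where step: "cf_step N (p, q) = (p', q')" by (metis surj_pair)
  note step1 = cf_step_reduced[OF assms red(1) step]
  note step2 = cf_step_reduced[OF assms red(2) step[unfolded eq]]
  have "q * q' = v * q'" using step1(3) step2(3) by linarith
  then have "q = v" using reduced_pos[OF step1(1)] by simp
  moreover have "\<lfloor>surd N (p, q)\<rfloor> * q - p = \<lfloor>surd N (u, v)\<rfloor> * v - u"
    using step1(2) step2(2) by (rule trans[OF sym])
  moreover have "\<lfloor>surd N (p, q)\<rfloor> = \<lfloor>surd N (u, v)\<rfloor>"
    using step1(5) step2(5) unfolding \<open>q = v\<close> by (rule trans[OF sym])
  ultimately show "p = u \<and> q = v" by simp
qed

lemma finite_reduced: "finite {s. reduced N s}"
proof (rule finite_subset)
  show "{s. reduced N s} \<subseteq> {0..\<lceil>sqrt N\<rceil>} \<times> {0..2 * \<lceil>sqrt N\<rceil>}"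
  proof
    fix s assume "s \<in> {s. reduced N s}"
    then obtain p q where s: "s = (p, q)" and red: "reduced N (p, q)" by (cases s) auto
    then have "p > 0" "q > 0" "p < sqrt N" "q < sqrt N + p"
      using reduced_pos[OF red] by (auto simp: reduced_def)
    moreover have "p \<le> \<lceil>sqrt N\<rceil>" using \<open>p < sqrt N\<close> by linarith
    moreover have "q \<le> 2 * \<lceil>sqrt N\<rceil>"
      using \<open>p < sqrt N\<close> \<open>q < sqrt N + p\<close> by linarith
    ultimately show "s \<in> {0..\<lceil>sqrt N\<rceil>} \<times> {0..2 * \<lceil>sqrt N\<rceil>}" by (simp add: s)
  qed
qed simp

section \<open>The starting pair\<close>

definition initial :: "nat \<Rightarrow> int \<times> int" where
  "initial N = (if even \<lfloor>sqrt N\<rfloor> then \<lfloor>sqrt N\<rfloor> - 1 else \<lfloor>sqrt N\<rfloor>, 2)"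

lemma normalized_sqrt_eq_surd: "normalized_sqrt N = surd N (initial N)"
  by (simp add: normalized_sqrt_def surd_def initial_def)

lemma odd_fst_initial: "odd (fst (initial N))"
  by (simp add: initial_def)

text \<open>The numerator is the largest odd integer below \<open>sqrt N\<close>, hence within
  distance 2 of it; as \<open>N\<close> is odd too, the denominator 2 divides
  \<open>N - p^2\<close>.\<close>

lemma reduced_initial:
  assumes "\<not> is_square N" "[N = 1] (mod 4)"
  shows "reduced N (initial N)"
proof -
  obtain p where init: "initial N = (p, 2)" by (simp add: initial_def)
  define r where "r = \<lfloor>sqrt N\<rfloor>"
  have p: "p = (if even r then r - 1 else r)" using init by (auto simp: initial_def r_def)
  have N4: "N mod 4 = 1" using assms(2) by (simp add: cong_def)
  \<comment> \<open>The congruence and the exclusion of the square 1 leave \<open>N > 4\<close>, so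
    that \<open>p \<ge> 1\<close> and \<open>2 < sqrt N + p\<close>.\<close>
  have "N \<noteq> 1" using assms(1) by (metis is_nth_power_1)
  then have "N > 4" using N4 by (cases "N = 0 \<or> N = 2 \<or> N = 3 \<or> N = 4") auto
  then have "sqrt N > 2" using real_less_rsqrt[of 2 "real N"] by simp
  then have "r \<ge> 2" by (simp add: r_def le_floor_iff)
  have "sqrt N \<noteq> r" using not_is_square_sqrt_irrational[OF assms(1), of 1 r] by simp
  then have r: "r < sqrt N" "sqrt N < r + 1" unfolding r_def by linarith+
  have "odd p" using odd_fst_initial[of N] init by simp
  moreover have "odd N" using N4 by presburger
  ultimately have "2 dvd int N - p\<^sup>2" by simp
  then show ?thesis
    unfolding init reduced_def using r p \<open>r \<ge> 2\<close> \<open>sqrt N > 2\<close> by (auto split: if_splits)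
qed

section \<open>Forward, backward and two-sided sequences of pairs\<close>

definition state :: "nat \<Rightarrow> nat \<Rightarrow> int \<times> int" where
  "state N n = (cf_step N ^^ n) (initial N)"

lemma state_0 [simp]: "state N 0 = initial N"
  and state_Suc [simp]: "state N (Suc n) = cf_step N (state N n)"
  by (simp_all add: state_def)

text \<open>The pair at index i is (P_{i-1}, Q_i). For negative i these come from y_{1-i} and
  y_{-i}, hence the two different indices; \<open>state\<close> serves for both because the backward
  terms turn out to be the forward ones.\<close>

definition two_sided_state :: "nat \<Rightarrow> int \<Rightarrow> int \<times> int" where
  "two_sided_state N i =
     (if i \<ge> 0 then state N (nat i)
      else (fst (state N (nat (1 - i))), snd (state N (nat (- i)))))"

context
  fixes N :: nat
  assumes nonsquare: "\<not> is_square N" and N1: "[N = 1] (mod 4)"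
begin

lemma reduced_state: "reduced N (state N n)"
proof (induction n)
  case 0
  show ?case using reduced_initial[OF nonsquare N1] by simp
next
  case (Suc n)
  obtain p q p' q' where "state N n = (p, q)" "cf_step N (p, q) = (p', q')"
    by (metis surj_pair)
  then show ?case using cf_step_reduced(1)[OF nonsquare, of p q p' q'] Suc by simp
qed

lemma fwd_eq_surd: "fwd N n = surd N (state N n)"
proof (induction n)
  case 0
  show ?case by (simp add: fwd_def normalized_sqrt_eq_surd)
next
  case (Suc n)
  have "fwd N (Suc n) = 1 / (fwd N n - of_int \<lfloor>fwd N n\<rfloor>)" by (simp add: fwd_def)
  also have "\<dots> = surd N (state N (Suc n))"
  proof -
    obtain p q p' q' where "state N n = (p, q)" "cf_step N (p, q) = (p', q')"
      by (metis surj_pair)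
    then show ?thesis
      using cf_step_reduced(6)[OF nonsquare, of p q p' q'] Suc reduced_state[of n] by simp
  qed
  finally show ?case .
qed

lemma surd_form_fwd: "surd_form N (fwd N n) (fst (state N n)) (snd (state N n))"
  using surd_form_surd[of N "fst (state N n)" "snd (state N n)"] reduced_state[of n]
  by (simp add: fwd_eq_surd)

lemma surd_P_fwd: "surd_P N (fwd N n) = fst (state N n)"
  by (rule surd_P_eq[OF nonsquare surd_form_fwd])

lemma surd_Q_fwd: "surd_Q N (fwd N n) = snd (state N n)"
  by (rule surd_Q_eq[OF nonsquare surd_form_fwd])

text \<open>This is P_0 = P_{-1}: the sum of the two is a multiple of Q_0 = 2, so the parities
  agree, and reducedness of \<open>(p, 2)\<close> and of the mixed pair \<open>(p', 2)\<close>
  confines both to an open interval of length 2.\<close>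

lemma fst_state_1: "fst (state N 1) = fst (initial N)"
proof -
  obtain p where init: "initial N = (p, 2)" by (simp add: initial_def)
  obtain p' q' where step: "cf_step N (p, 2) = (p', q')" by (metis surj_pair)
  have red: "reduced N (p, 2)" using reduced_state[of 0] init by simp
  have "p' = \<lfloor>surd N (p, 2)\<rfloor> * 2 - p" and red': "reduced N (p', 2)"
    using cf_step_reduced(2,4)[OF nonsquare red step] by auto
  moreover have "odd p" using odd_fst_initial[of N] init by simp
  ultimately have "even (p' - p)" by simp
  moreover have "\<bar>p' - p\<bar> < 2" using red red' unfolding reduced_def by auto
  ultimately have "p' = p" by presburger
  then show ?thesis using init step by simp
qed

lemma bwd_eq_fwd: "bwd N = fwd N"
proof
  fix j
  have "bwd N j = complete_quotient (surd N (initial N)) j"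
    unfolding bwd_def surd_P_fwd surd_Q_fwd fst_state_1 by (simp add: surd_def split_beta)
  then show "bwd N j = fwd N j" by (simp add: fwd_def normalized_sqrt_eq_surd)
qed

lemma cf_P_eq: "cf_P N (i - 1) = fst (two_sided_state N i)"
  by (simp add: cf_P_def bwd_eq_fwd surd_P_fwd two_sided_state_def)

lemma cf_P_eq': "cf_P N i = fst (two_sided_state N (i + 1))"
  using cf_P_eq[of "i + 1"] by simp

lemma cf_Q_eq: "cf_Q N i = snd (two_sided_state N i)"
  by (simp add: cf_Q_def bwd_eq_fwd surd_Q_fwd two_sided_state_def)

lemma cf_x_eq: "cf_x N i = surd N (two_sided_state N i)"
  by (simp add: cf_x_def cf_P_eq cf_Q_eq fwd_eq_surd two_sided_state_def surd_def split_beta)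

lemma cf_Q_symmetric: "cf_Q N i = cf_Q N (- i)"
  by (simp add: cf_Q_def bwd_eq_fwd)

text \<open>At negative indices the pairs are the mixed pairs of the forward sequence, traversed
  backwards, so \<open>cf_step_reverse\<close> supplies the step.\<close>

lemma two_sided_state_step:
  "reduced N (two_sided_state N i) \<and>
   cf_step N (two_sided_state N i) = two_sided_state N (i + 1)"
proof (cases "i \<ge> 0")
  case True
  then have "nat (i + 1) = Suc (nat i)" by simp
  with True show ?thesis by (simp add: two_sided_state_def reduced_state)
next
  case False
  define n where "n = nat (- i - 1)"
  have i: "i = - int n - 1" using False by (simp add: n_def)
  obtain p q p' q' p'' q''
    where st: "state N n = (p, q)" "state N (Suc n) = (p', q')" "state N (Suc (Suc n)) = (p'', q'')"
    by (cases "state N n", cases "state N (Suc n)", cases "state N (Suc (Suc n))")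
  have "nat (1 - i) = Suc (Suc n)" "nat (- i) = Suc n" by (auto simp: i)
  with False st have "two_sided_state N i = (p'', q')" by (simp add: two_sided_state_def)
  moreover have "two_sided_state N (i + 1) = (p', q)"
  proof (cases n)
    \<comment> \<open>Passing from index -1 to index 0 joins the two halves: the mixed pair has to
      be the initial pair, which needs P_0 = P_{-1}.\<close>
    case 0
    then show ?thesis using st fst_state_1 by (auto simp: i two_sided_state_def)
  next
    case (Suc m)
    have "nat (1 - (i + 1)) = Suc n" "nat (- (i + 1)) = n" by (auto simp: i)
    then show ?thesis using st Suc by (simp add: i two_sided_state_def)
  qed
  moreover have "reduced N (p'', q') \<and> cf_step N (p'', q') = (p', q)"
    using st reduced_state[of n] by (intro cf_step_reverse[OF nonsquare]) auto
  ultimately show ?thesis by simp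
qed

section \<open>Periodicity\<close>

lemma two_sided_state_periodic:
  "\<exists>\<pi>>0. \<forall>i. two_sided_state N i = two_sided_state N (i + \<pi>)"
proof -
  have "finite (range (state N))"
    by (rule finite_subset[OF _ finite_reduced]) (use reduced_state in auto)
  then have "\<not> inj (state N)" using finite_imageD infinite_UNIV_nat by blast
  then obtain m n where "m < n" "state N m = state N n"
    by (metis linorder_injI)
  define \<pi> where "\<pi> = int n - int m"
  have base: "two_sided_state N (int m) = two_sided_state N (int m + \<pi>)"
    using \<open>state N m = state N n\<close> by (simp add: two_sided_state_def \<pi>_def)
  have "two_sided_state N i = two_sided_state N (i + \<pi>)" for i
  \<comment> \<open>Upwards from \<open>m\<close> both sides are advanced by one step; downwards
    injectivity on reduced pairs cancels a step, so the period extends to all integers.\<close>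
  proof (induction i rule: int_induct[where k = "int m"])
    case base
    show ?case by (fact \<open>two_sided_state N (int m) = _\<close>)
  next
    case (step1 i)
    then show ?case
      using two_sided_state_step[of i] two_sided_state_step[of "i + \<pi>"] by (simp add: ac_simps)
  next
    case (step2 i)
    have "i - 1 + \<pi> + 1 = i + \<pi>" by simp
    then have "cf_step N (two_sided_state N (i - 1)) = cf_step N (two_sided_state N (i - 1 + \<pi>))"
      using two_sided_state_step[of "i - 1"] two_sided_state_step[of "i - 1 + \<pi>"] step2(2)
      by (metis diff_add_cancel)
    then show ?case
      by (rule inj_onD[OF inj_on_cf_step[OF nonsquare]]) (simp_all add: two_sided_state_step)
  qed
  then show ?thesis using \<open>m < n\<close> by (intro exI[of _ \<pi>]) (simp add: \<pi>_def)
qed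

section \<open>The identities for P, Q and b\<close>

lemma cf_b_eq: "cf_b N i = \<lfloor>surd N (two_sided_state N i)\<rfloor>"
  by (simp add: cf_b_def cf_x_eq)

text \<open>Each claim involves only two consecutive pairs of the two-sided sequence, so the sign of
  \<open>i\<close> no longer matters and \<open>cf_step_reduced\<close> applies uniformly.\<close>

lemma cf_local_properties:
  shows "surd_form N (cf_x N i) (cf_P N (i - 1)) (cf_Q N i)"
    and "real N = (cf_P N i)\<^sup>2 + cf_Q N i * cf_Q N (i + 1)"
    and "cf_P N i = of_int (cf_b N i) * cf_Q N i - cf_P N (i - 1)"
    and "cf_b N i = \<lfloor>(of_int \<lfloor>sqrt N\<rfloor> + cf_P N (i - 1)) / cf_Q N i\<rfloor>"
    and "cf_b N i \<ge> 1"
    and "0 < cf_P N i" "cf_P N i < sqrt N"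
    and "\<bar>sqrt N - cf_Q N i\<bar> < cf_P N (i - 1)"
    and "cf_Q N i > 0"
    and "\<lfloor>(sqrt N + cf_P N i) / cf_Q N i\<rfloor> = cf_b N i"
    and "\<lfloor>(sqrt N + cf_P N (i - 1)) / cf_Q N i\<rfloor> = cf_b N i"
proof -
  obtain p q p' q'
    where st: "two_sided_state N i = (p, q)" and st': "two_sided_state N (i + 1) = (p', q')"
    by (cases "two_sided_state N i", cases "two_sided_state N (i + 1)")
  have red: "reduced N (p, q)" and step: "cf_step N (p, q) = (p', q')"
    using two_sided_state_step[of i] st st' by auto
  note props = cf_step_reduced[OF nonsquare red step]
  have eqs: "cf_P N (i - 1) = p" "cf_Q N i = q" "cf_P N i = p'" "cf_Q N (i + 1) = q'"
    "cf_x N i = surd N (p, q)" "cf_b N i = \<lfloor>surd N (p, q)\<rfloor>"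
    using st st' by (simp_all add: cf_P_eq cf_P_eq' cf_Q_eq cf_x_eq cf_b_eq)
  show "surd_form N (cf_x N i) (cf_P N (i - 1)) (cf_Q N i)"
    unfolding eqs using surd_form_surd[OF red] .
  have "of_int (int N) = (of_int (p'\<^sup>2 + q * q') :: real)" using props(3) by simp
  then show "real N = (cf_P N i)\<^sup>2 + cf_Q N i * cf_Q N (i + 1)" by (simp add: eqs)
  show "cf_P N i = of_int (cf_b N i) * cf_Q N i - cf_P N (i - 1)"
    unfolding eqs using props(2) by simp
  show "cf_b N i = \<lfloor>(of_int \<lfloor>sqrt N\<rfloor> + cf_P N (i - 1)) / cf_Q N i\<rfloor>"
    unfolding eqs using floor_surd_floor_sqrt[OF red] by simp
  show "cf_b N i \<ge> 1" unfolding eqs by (rule floor_surd_ge_1[OF red])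
  show "0 < cf_P N i" "cf_P N i < sqrt N"
    unfolding eqs using reduced_pos[OF props(1)] props(1) by (auto simp: reduced_def)
  show "\<bar>sqrt N - cf_Q N i\<bar> < cf_P N (i - 1)"
    unfolding eqs using red by (auto simp: reduced_def)
  show "cf_Q N i > 0" unfolding eqs using reduced_pos[OF red] by simp
  show "\<lfloor>(sqrt N + cf_P N i) / cf_Q N i\<rfloor> = cf_b N i"
    unfolding eqs using props(5) by (simp add: surd_def)
  show "\<lfloor>(sqrt N + cf_P N (i - 1)) / cf_Q N i\<rfloor> = cf_b N i"
    unfolding eqs by (simp add: surd_def)
qed

text \<open>Equating the expressions for \<open>N\<close> at \<open>i\<close> and
  \<open>i - 1\<close> leaves a difference of squares; its factor P_{i-1} + P_i is b_i Q_i, and the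
  positive Q_i cancels.\<close>

lemma cf_Q_recurrence:
  "cf_Q N (i + 1) = cf_Q N (i - 1) + of_int (cf_b N i) * (cf_P N (i - 1) - cf_P N i)"
proof -
  have "(cf_P N i)\<^sup>2 + cf_Q N i * cf_Q N (i + 1) = (cf_P N (i - 1))\<^sup>2 + cf_Q N (i - 1) * cf_Q N i"
    using cf_local_properties(2)[of i] cf_local_properties(2)[of "i - 1"] by simp
  moreover note cf_local_properties(3)[of i]
  ultimately have "cf_Q N i * cf_Q N (i + 1) =
      cf_Q N i * (cf_Q N (i - 1) + of_int (cf_b N i) * (cf_P N (i - 1) - cf_P N i))"
    by algebra
  then show ?thesis using cf_local_properties(9)[of i] by simp
qed

end

theorem theorem2p8:
  fixes N :: nat
  assumes "N > 0" and "\<not> is_square N" and "[N = 1] (mod 4)"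
  shows
    "(\<forall>i. surd_form N (cf_x N i) (cf_P N (i - 1)) (cf_Q N i) \<and>
          (\<forall>p q. surd_form N (cf_x N i) p q \<longrightarrow> p = cf_P N (i - 1) \<and> q = cf_Q N i)) \<and>
     (\<forall>i. real N = (cf_P N i)\<^sup>2 + cf_Q N i * cf_Q N (i + 1)) \<and>
     (\<forall>i. cf_P N i = of_int (cf_b N i) * cf_Q N i - cf_P N (i - 1)) \<and>
     (\<forall>i. cf_b N i = \<lfloor>(of_int \<lfloor>sqrt N\<rfloor> + cf_P N (i - 1)) / cf_Q N i\<rfloor> \<and> cf_b N i \<ge> 1) \<and>
     (\<forall>i. 0 < cf_P N i \<and> cf_P N i < sqrt N) \<and>
     (\<forall>i. \<bar>sqrt N - cf_Q N i\<bar> < cf_P N (i - 1)) \<and>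
     (\<forall>i. cf_Q N i \<in> \<int>) \<and>
     (\<forall>i. cf_Q N (i + 1) = cf_Q N (i - 1) + of_int (cf_b N i) * (cf_P N (i - 1) - cf_P N i)) \<and>
     (\<forall>i. \<lfloor>(sqrt N + cf_P N i) / cf_Q N i\<rfloor> = \<lfloor>(sqrt N + cf_P N (i - 1)) / cf_Q N i\<rfloor> \<and>
          \<lfloor>(sqrt N + cf_P N (i - 1)) / cf_Q N i\<rfloor> = cf_b N i) \<and>
     (\<exists>i\<^sub>0 \<pi>. \<pi> > 0 \<and> (\<forall>i\<ge>i\<^sub>0. cf_x N (i + \<pi>) = cf_x N i)) \<and>
     (\<exists>\<pi>>0. \<forall>i. cf_x N i = cf_x N (i + \<pi>)) \<and>
     (\<exists>k::int. 2 * cf_P N (-1) = of_int k * cf_Q N 0) \<and>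
     (\<forall>i. cf_Q N i = cf_Q N (- i))"
proof (intro conjI)
  note props = cf_local_properties[OF assms(2,3)]
  show "\<forall>i. surd_form N (cf_x N i) (cf_P N (i - 1)) (cf_Q N i) \<and>
      (\<forall>p q. surd_form N (cf_x N i) p q \<longrightarrow> p = cf_P N (i - 1) \<and> q = cf_Q N i)"
    using props(1) surd_form_unique[OF assms(2)] by blast
  show "\<forall>i. cf_Q N i \<in> \<int>"
    using props(1) by (simp add: surd_form_def)
  obtain \<pi> where "\<pi> > 0" and "\<forall>i. cf_x N i = cf_x N (i + \<pi>)"
    using two_sided_state_periodic[OF assms(2,3)] by (metis cf_x_eq[OF assms(2,3)])
  then show "\<exists>\<pi>>0. \<forall>i. cf_x N i = cf_x N (i + \<pi>)"
    and "\<exists>i\<^sub>0 \<pi>. \<pi> > 0 \<and> (\<forall>i\<ge>i\<^sub>0. cf_x N (i + \<pi>) = cf_x N i)"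
    by metis+
  have "cf_Q N 0 = 2"
    by (simp add: cf_Q_eq[OF assms(2,3)] two_sided_state_def initial_def)
  moreover have "cf_P N (-1) = fst (initial N)"
    by (simp add: cf_P_eq'[OF assms(2,3)] two_sided_state_def)
  \<comment> \<open>With Q_0 = 2 the witness is P_{-1} itself.\<close>
  ultimately show "\<exists>k::int. 2 * cf_P N (-1) = of_int k * cf_Q N 0" by auto
  show "\<forall>i. cf_Q N i = cf_Q N (- i)"
    using cf_Q_symmetric[OF assms(2,3)] by blast
  show "\<forall>i. cf_Q N (i + 1) = cf_Q N (i - 1) + of_int (cf_b N i) * (cf_P N (i - 1) - cf_P N i)"
    using cf_Q_recurrence[OF assms(2,3)] by blast
  show "\<forall>i. cf_b N i = \<lfloor>(of_int \<lfloor>sqrt N\<rfloor> + cf_P N (i - 1)) / cf_Q N i\<rfloor> \<and> cf_b N i \<ge> 1"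
    using props(4,5) by blast
  show "\<forall>i. \<lfloor>(sqrt N + cf_P N i) / cf_Q N i\<rfloor> = \<lfloor>(sqrt N + cf_P N (i - 1)) / cf_Q N i\<rfloor> \<and>
      \<lfloor>(sqrt N + cf_P N (i - 1)) / cf_Q N i\<rfloor> = cf_b N i"
    by (simp only: props(10,11) simp_thms)
qed (use cf_local_properties[OF assms(2,3)] in blast)+

end
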